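(* Let $\mathbf{P}$ be a connected, locally finite poset. For any interval decomposable $F:\mathbf{P}\to\mathbf{vec}$ and any $J\in\mathbf{Con}(\mathbf{P})$, $\mathrm{rk}(F)(J)$ is equal to the total multiplicity of intervals $K\in\mathrm{barc}^{\mathbf{P}}(F)$ such that $K\supset J$.
   Context: Fix a field $\mathbb{F}$; $\mathbf{vec}$ (resp. $\mathbf{Vec}$) is the category of finite-dimensional (resp. all) vector spaces over $\mathbb{F}$. A poset is regarded as a category with a unique morphism $p\to q$ iff $p\le q$. Inclusions $\supset$ are not necessarily strict. A poset $\mathbf{P}$ is connected if any $p,q\in\mathbf{P}$ are joined by a finite sequence $p=p_0,\dots,p_n=q$ with $p_i,p_{i+1}$ comparable for all $i$. It is locally finite if $\{r: p\le r\le q\}$ is finite for all $p\le q$. Write $p\asymp q$ if one of $p,q$ covers the other. The Hasse diagram $\mathrm{Hasse}(\mathbf{P})$ is the simple graph on $\mathbf{P}$ with $p,q$ adjacent iff $p\asymp q$. $\mathbf{Con}(\mathbf{P})$ is the collection of all subposets $I\subset\mathbf{P}$ such that the induced subgraph of $\mathrm{Hasse}(\mathbf{P})$ on $I$ is a connected (nonempty) graph. Intervals of $\mathbf{P}$ are nonempty subsets $\mathcal{J}$ that are connected as posets and convex ($r,t\in\mathcal{J}$, $r\le s\le t$ imply $s\in\mathcal{J}$). For $J\in\mathbf{Con}(\mathbf{P})$, $\mathrm{rk}(F)(J)$ is the rank (dimension of the image) of the canonical map $\varprojlim F|_J\to\varinjlim F|_J$ in $\mathbf{Vec}$, i.e.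 the composite $\varprojlim F|_J\to F_a\to\varinjlim F|_J$ of the structure maps for any $a\in J$ (independent of $a$). For an interval $\mathcal{J}$, the interval module $I^{\mathcal{J}}:\mathbf{P}\to\mathbf{vec}$ has value $\mathbb{F}$ on $\mathcal{J}$ and $0$ elsewhere, with identity maps between points of $\mathcal{J}$ and zero maps otherwise. $F$ is interval decomposable if $F\cong\bigoplus_{\mathcal{J}\in\mathrm{barc}^{\mathbf{P}}(F)}I^{\mathcal{J}}$ for some multiset $\mathrm{barc}^{\mathbf{P}}(F)$ of intervals of $\mathbf{P}$; this multiset is unique and is called the barcode of $F$. *)

theory Defs
  imports "Jordan_Normal_Form.Missing_VectorSpace" "HOL-Algebra.AbelCoset"
begin

subsection \<open>Posets\<close>

definition poset_connected :: "'p::order set \<Rightarrow> bool" where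
  "poset_connected S \<longleftrightarrow>
     (\<forall>p\<in>S. \<forall>q\<in>S. (p, q) \<in> {(x, y). x \<in> S \<and> y \<in> S \<and> (x \<le> y \<or> y \<le> x)}\<^sup>*)"

definition poset_convex :: "'p::order set \<Rightarrow> bool" where
  "poset_convex S \<longleftrightarrow> (\<forall>r\<in>S. \<forall>t\<in>S. \<forall>s. r \<le> s \<longrightarrow> s \<le> t \<longrightarrow> s \<in> S)"

definition poset_interval :: "'p::order set \<Rightarrow> bool" where
  "poset_interval S \<longleftrightarrow> S \<noteq> {} \<and> poset_connected S \<and> poset_convex S"

definition covers :: "'p::order \<Rightarrow> 'p \<Rightarrow> bool" where
  "covers q p \<longleftrightarrow> p < q \<and> \<not> (\<exists>r. p < r \<and> r < q)"

definition hasse :: "('p::order \<times> 'p) set" where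
  "hasse = {(p, q). covers p q \<or> covers q p}"

definition Con :: "'p::order set set" where
  "Con = {J. J \<noteq> {} \<and> (\<forall>p\<in>J. \<forall>q\<in>J. (p, q) \<in> (hasse \<inter> J \<times> J)\<^sup>*)}"

subsection \<open>Products, direct sums and quotients of vector spaces\<close>

text \<open>The fields \<open>mult\<close> and \<open>one\<close> of a module record play no role; they are left unspecified.\<close>

definition dprod :: "'i set \<Rightarrow> ('i \<Rightarrow> ('k, 'v) module) \<Rightarrow> ('k, 'i \<Rightarrow> 'v) module" where
  "dprod A M =
     \<lparr>carrier = (\<Pi>\<^sub>E i\<in>A. carrier (M i)),
      mult = undefined, one = undefined,
      zero = (\<lambda>i\<in>A. \<zero>\<^bsub>M i\<^esub>),
      add = (\<lambda>f g. \<lambda>i\<in>A. f i \<oplus>\<^bsub>M i\<^esub> g i),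
      smult = (\<lambda>c f. \<lambda>i\<in>A. c \<odot>\<^bsub>M i\<^esub> f i)\<rparr>"

definition dsum :: "'i set \<Rightarrow> ('i \<Rightarrow> ('k, 'v) module) \<Rightarrow> ('k, 'i \<Rightarrow> 'v) module" where
  "dsum A M = (dprod A M)
     \<lparr>carrier := {f \<in> carrier (dprod A M). finite {i \<in> A. f i \<noteq> \<zero>\<^bsub>M i\<^esub>}}\<rparr>"

definition dsum_inj :: "'i set \<Rightarrow> ('i \<Rightarrow> ('k, 'v) module) \<Rightarrow> 'i \<Rightarrow> 'v \<Rightarrow> ('i \<Rightarrow> 'v)" where
  "dsum_inj A M j v = (\<lambda>i\<in>A. if i = j then v else \<zero>\<^bsub>M i\<^esub>)"

definition quot_module :: "('k, 'v) module \<Rightarrow> 'v set \<Rightarrow> ('k, 'v set) module" where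
  "quot_module M N =
     \<lparr>carrier = a_rcosets\<^bsub>M\<^esub> N,
      mult = undefined, one = undefined,
      zero = N,
      add = (\<lambda>X Y. X <+>\<^bsub>M\<^esub> Y),
      smult = (\<lambda>c X. \<Union>x\<in>X. N +>\<^bsub>M\<^esub> (c \<odot>\<^bsub>M\<^esub> x))\<rparr>"

subsection \<open>Functors from a poset to vector spaces\<close>

record ('p, 'k, 'v) persmod =
  fiber :: "'p \<Rightarrow> ('k, 'v) module"
  trans_map :: "'p \<Rightarrow> 'p \<Rightarrow> 'v \<Rightarrow> 'v"

text \<open>Functors into \<open>Vec\<close> and into \<open>vec\<close>, respectively. Only the restriction of
  \<open>trans_map F p q\<close> with \<open>p \<le> q\<close> to the carrier of \<open>fiber F p\<close> is meaningful.\<close>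

locale Vec_functor = field K for K :: "('k, 'c) ring_scheme" (structure)
  and F :: "('p::order, 'k, 'v) persmod" +
  assumes vs: "vectorspace K (fiber F p)"
    and lin: "p \<le> q \<Longrightarrow> linear_map K (fiber F p) (fiber F q) (trans_map F p q)"
    and ident: "v \<in> carrier (fiber F p) \<Longrightarrow> trans_map F p p v = v"
    and comp: "\<lbrakk>p \<le> q; q \<le> r; v \<in> carrier (fiber F p)\<rbrakk> \<Longrightarrow>
      trans_map F q r (trans_map F p q v) = trans_map F p r v"

locale vec_functor = Vec_functor +
  assumes fin_dim: "vectorspace.fin_dim K (fiber F p)"

definition pers_iso ::
    "('k, 'c) ring_scheme \<Rightarrow> ('p::order, 'k, 'v) persmod \<Rightarrow> ('p, 'k, 'w) persmod \<Rightarrow> bool" where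
  "pers_iso K F G \<longleftrightarrow> (\<exists>\<eta>.
     (\<forall>p. linear_map K (fiber F p) (fiber G p) (\<eta> p) \<and>
          bij_betw (\<eta> p) (carrier (fiber F p)) (carrier (fiber G p))) \<and>
     (\<forall>p q. p \<le> q \<longrightarrow> (\<forall>v\<in>carrier (fiber F p).
          \<eta> q (trans_map F p q v) = trans_map G p q (\<eta> p v))))"

definition pers_dsum ::
    "'i set \<Rightarrow> ('i \<Rightarrow> ('p, 'k, 'v) persmod) \<Rightarrow> ('p, 'k, 'i \<Rightarrow> 'v) persmod" where
  "pers_dsum A M =
     \<lparr>fiber = (\<lambda>p. dsum A (\<lambda>i. fiber (M i) p)),
      trans_map = (\<lambda>p q f. \<lambda>i\<in>A. trans_map (M i) p q (f i))\<rparr>"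

definition interval_module :: "('k, 'c) ring_scheme \<Rightarrow> 'p set \<Rightarrow> ('p, 'k, 'k) persmod" where
  "interval_module K S =
     \<lparr>fiber = (\<lambda>p. \<lparr>carrier = (if p \<in> S then carrier K else {\<zero>\<^bsub>K\<^esub>}),
                   mult = undefined, one = undefined,
                   zero = \<zero>\<^bsub>K\<^esub>, add = (\<oplus>\<^bsub>K\<^esub>), smult = (\<otimes>\<^bsub>K\<^esub>)\<rparr>),
      trans_map = (\<lambda>p q v. if p \<in> S \<and> q \<in> S then v else \<zero>\<^bsub>K\<^esub>)\<rparr>"

text \<open>A multiset of intervals is given by its multiplicity function \<open>B\<close>, with the copies of
  \<open>S\<close> indexed by \<open>(S, 0), \<dots>, (S, B S - 1)\<close>. It may have infinitely many elements in total,
  which the type \<open>multiset\<close> would exclude; each single multiplicity is finite, since an interval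
  is nonempty and the functors of interest are pointwise finite-dimensional.\<close>

definition is_barcode ::
    "('k, 'c) ring_scheme \<Rightarrow> ('p::order, 'k, 'v) persmod \<Rightarrow> ('p set \<Rightarrow> nat) \<Rightarrow> bool" where
  "is_barcode K F B \<longleftrightarrow>
     (\<forall>S. 0 < B S \<longrightarrow> poset_interval S) \<and>
     pers_iso K F (pers_dsum {(S, i). i < B S} (\<lambda>(S, i). interval_module K S))"

definition interval_decomposable ::
    "('k, 'c) ring_scheme \<Rightarrow> ('p::order, 'k, 'v) persmod \<Rightarrow> bool" where
  "interval_decomposable K F \<longleftrightarrow> (\<exists>B. is_barcode K F B)"

subsection \<open>Limits, colimits and the rank\<close>

definition lim_restr ::
    "('p::order, 'k, 'v) persmod \<Rightarrow> 'p set \<Rightarrow> ('k, 'p \<Rightarrow> 'v) module" where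
  "lim_restr F J = (dprod J (fiber F))
     \<lparr>carrier := {s \<in> carrier (dprod J (fiber F)).
        \<forall>p\<in>J. \<forall>q\<in>J. p \<le> q \<longrightarrow> trans_map F p q (s p) = s q}\<rparr>"

definition colim_rels ::
    "('k, 'c) ring_scheme \<Rightarrow> ('p::order, 'k, 'v) persmod \<Rightarrow> 'p set \<Rightarrow> ('p \<Rightarrow> 'v) set" where
  "colim_rels K F J = module.span K (dsum J (fiber F))
     {dsum_inj J (fiber F) p v \<ominus>\<^bsub>dsum J (fiber F)\<^esub> dsum_inj J (fiber F) q (trans_map F p q v)
      | p q v. p \<in> J \<and> q \<in> J \<and> p \<le> q \<and> v \<in> carrier (fiber F p)}"

definition colim_restr ::
    "('k, 'c) ring_scheme \<Rightarrow> ('p::order, 'k, 'v) persmod \<Rightarrow> 'p set \<Rightarrow> ('k, ('p \<Rightarrow> 'v) set) module"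
  where "colim_restr K F J = quot_module (dsum J (fiber F)) (colim_rels K F J)"

definition colim_inj ::
    "('k, 'c) ring_scheme \<Rightarrow> ('p::order, 'k, 'v) persmod \<Rightarrow> 'p set \<Rightarrow> 'p \<Rightarrow> 'v \<Rightarrow> ('p \<Rightarrow> 'v) set"
  where "colim_inj K F J p v = colim_rels K F J +>\<^bsub>dsum J (fiber F)\<^esub> dsum_inj J (fiber F) p v"

text \<open>The composite of the structure maps at an arbitrary point of \<open>J\<close>; the lemma
  \<open>canonical_map_eq\<close> below shows that it does not depend on the point.\<close>

definition canonical_map ::
    "('k, 'c) ring_scheme \<Rightarrow> ('p::order, 'k, 'v) persmod \<Rightarrow> 'p set \<Rightarrow> ('p \<Rightarrow> 'v) \<Rightarrow> ('p \<Rightarrow> 'v) set"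
  where "canonical_map K F J s = (let a = (SOME a. a \<in> J) in colim_inj K F J a (s a))"

definition rk :: "('k, 'c) ring_scheme \<Rightarrow> ('p::order, 'k, 'v) persmod \<Rightarrow> 'p set \<Rightarrow> nat" where
  "rk K F J = vectorspace.dim K
     ((colim_restr K F J)\<lparr>carrier := canonical_map K F J ` carrier (lim_restr F J)\<rparr>)"

subsection \<open>Well-definedness of the rank\<close>

lemma dprod_vs:
  assumes K: "field K" and M: "\<And>i. i \<in> A \<Longrightarrow> vectorspace K (M i)"
  shows "vectorspace K (dprod A M)"
proof -
  have mod: "module K (M i)" and ag: "abelian_group (M i)" and am: "abelian_monoid (M i)"
    if "i \<in> A" for i
    using M[OF that] by (auto simp: vectorspace_def module_def abelian_group_def)
  interpret K: field K by (rule K)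
  note s = module.smult_closed[OF mod] module.smult_l_distr[OF mod] module.smult_r_distr[OF mod]
    module.smult_assoc1[OF mod] module.smult_one[OF mod]
    abelian_monoid.l_zero[OF am] abelian_monoid.r_zero[OF am] abelian_monoid.zero_closed[OF am]
    abelian_monoid.a_closed[OF am] abelian_monoid.a_assoc[OF am]
    abelian_group.r_neg[OF ag] abelian_group.a_inv_closed[OF ag]
  show ?thesis
  proof (rule vs_criteria[OF K]; (intro allI ballI impI)?)
    fix v assume v: "v \<in> carrier (dprod A M)"
    show "\<exists>w\<in>carrier (dprod A M). v \<oplus>\<^bsub>dprod A M\<^esub> w = \<zero>\<^bsub>dprod A M\<^esub>"
      by (rule bexI[of _ "\<lambda>i\<in>A. \<ominus>\<^bsub>M i\<^esub> v i"])
        (use v in \<open>auto simp: dprod_def PiE_iff s fun_eq_iff\<close>)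
  next
    fix v w assume "v \<in> carrier (dprod A M) \<and> w \<in> carrier (dprod A M)"
    then show "v \<oplus>\<^bsub>dprod A M\<^esub> w = w \<oplus>\<^bsub>dprod A M\<^esub> v"
      by (auto simp: dprod_def PiE_iff fun_eq_iff intro: abelian_monoid.a_comm[OF am])
  qed (auto simp: dprod_def PiE_iff s fun_eq_iff extensional_def)
qed

lemma dsum_vs:
  assumes K: "field K" and M: "\<And>i. i \<in> A \<Longrightarrow> vectorspace K (M i)"
  shows "vectorspace K (dsum A M)"
proof -
  interpret P: vectorspace K "dprod A M" by (rule dprod_vs[OF assms])
  have mod: "module K (M i)" and am: "abelian_monoid (M i)" if "i \<in> A" for i
    using M[OF that] by (auto simp: vectorspace_def module_def abelian_group_def)
  note s = abelian_monoid.l_zero[OF am] abelian_monoid.zero_closed[OF am] module.rmult_0[OF mod]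
  have fin_add: "finite {i \<in> A. f i \<oplus>\<^bsub>M i\<^esub> g i \<noteq> \<zero>\<^bsub>M i\<^esub>}"
    if "finite {i \<in> A. f i \<noteq> \<zero>\<^bsub>M i\<^esub>}" "finite {i \<in> A. g i \<noteq> \<zero>\<^bsub>M i\<^esub>}" for f g
    by (rule finite_subset[OF _ finite_UnI[OF that]]) (auto simp: s)
  have fin_smult: "finite {i \<in> A. c \<odot>\<^bsub>M i\<^esub> f i \<noteq> \<zero>\<^bsub>M i\<^esub>}"
    if "finite {i \<in> A. f i \<noteq> \<zero>\<^bsub>M i\<^esub>}" "c \<in> carrier K" for f c
    by (rule finite_subset[OF _ that(1)]) (use that(2) in \<open>auto simp: s\<close>)
  let ?C = "{f \<in> carrier (dprod A M). finite {i \<in> A. f i \<noteq> \<zero>\<^bsub>M i\<^esub>}}"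
  have "LinearCombinations.submodule K ?C (dprod A M)"
  proof (unfold_locales, goal_cases)
    case (2 v w)
    then have "v \<oplus>\<^bsub>dprod A M\<^esub> w \<in> carrier (dprod A M)" by auto
    with 2 show ?case using fin_add[of v w] by (auto simp: dprod_def cong: conj_cong)
  next
    case 3
    then show ?case using P.zero_closed by (auto simp: dprod_def cong: conj_cong)
  next
    case (4 c v)
    then have "c \<odot>\<^bsub>dprod A M\<^esub> v \<in> carrier (dprod A M)" by auto
    with 4 show ?case using fin_smult[of v c] by (auto simp: dprod_def cong: conj_cong)
  qed auto
  then have "subspace K ?C (dprod A M)"
    by (simp add: subspace_def P.vectorspace_axioms)
  then show ?thesis
    unfolding dsum_def by (rule P.subspace_is_vs)
qed

lemma dsum_inj_linear:
  assumes K: "field K" and M: "\<And>i. i \<in> A \<Longrightarrow> vectorspace K (M i)" and j: "j \<in> A"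
  shows "linear_map K (M j) (dsum A M) (dsum_inj A M j)"
proof -
  have mod: "module K (M i)" and am: "abelian_monoid (M i)" if "i \<in> A" for i
    using M[OF that] by (auto simp: vectorspace_def module_def abelian_group_def)
  note s = abelian_monoid.l_zero[OF am] abelian_monoid.zero_closed[OF am] module.rmult_0[OF mod]
  have fin: "finite {i \<in> A. dsum_inj A M j v i \<noteq> \<zero>\<^bsub>M i\<^esub>}" for v
    by (rule finite_subset[of _ "{j}"]) (auto simp: dsum_inj_def)
  have "dsum_inj A M j \<in> module_hom K (M j) (dsum A M)"
    using fin j by (auto simp: module_hom_def dsum_def dprod_def dsum_inj_def s fun_eq_iff)
  then show ?thesis
    using dsum_vs[OF K M] M[OF j]
    by (auto simp: linear_map_def mod_hom_def mod_hom_axioms_def vectorspace_def)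
qed

lemma quot_module:
  assumes M: "vectorspace K M" and N: "LinearCombinations.submodule K N M"
  shows quot_module_vs: "vectorspace K (quot_module M N)"
    and quot_module_proj: "linear_map K M (quot_module M N) (\<lambda>x. N +>\<^bsub>M\<^esub> x)"
    and quot_module_proj_eq: "\<And>x y. \<lbrakk>x \<in> carrier M; y \<in> carrier M\<rbrakk> \<Longrightarrow>
           (N +>\<^bsub>M\<^esub> x = N +>\<^bsub>M\<^esub> y) \<longleftrightarrow> x \<ominus>\<^bsub>M\<^esub> y \<in> N"
proof -
  interpret M: vectorspace K M by (rule M)
  interpret N: LinearCombinations.submodule K N M by (rule N)
  have neg: "\<ominus>\<^bsub>M\<^esub> v \<in> N" if "v \<in> N" for v
  proof -
    have "v \<in> carrier M" using that N.subset by auto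
    then show ?thesis
      using N.smult_closed[OF _ that, of "\<ominus>\<^bsub>K\<^esub> \<one>\<^bsub>K\<^esub>"] M.smult_minus_1[of v] by simp
  qed
  interpret S: abelian_subgroup N M
  proof (rule abelian_subgroupI3[OF additive_subgroup.intro M.abelian_group_axioms])
    have "N \<noteq> {}" using N.zero_closed by blast
    then show "subgroup N (add_monoid M)"
      using N.subset N.m_closed neg
      by (intro M.add.subgroupI) (auto simp flip: a_inv_def)
  qed
  show eq: "(N +>\<^bsub>M\<^esub> x = N +>\<^bsub>M\<^esub> y) \<longleftrightarrow> x \<ominus>\<^bsub>M\<^esub> y \<in> N"
    if "x \<in> carrier M" "y \<in> carrier M" for x y
    using S.a_rcos_module[of y x] S.a_repr_independence'[of x y] S.a_repr_independenceD[of x y] that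
    unfolding a_minus_def by metis
  have rc: "a_rcosets\<^bsub>M\<^esub> N = (\<lambda>x. N +>\<^bsub>M\<^esub> x) ` carrier M"
    by (auto simp: A_RCOSETS_def RCOSETS_def a_r_coset_def)
  have sm: "(\<Union>y\<in>N +>\<^bsub>M\<^esub> x. N +>\<^bsub>M\<^esub> (c \<odot>\<^bsub>M\<^esub> y)) = N +>\<^bsub>M\<^esub> (c \<odot>\<^bsub>M\<^esub> x)"
    if c: "c \<in> carrier K" and x: "x \<in> carrier M" for c x
  proof -
    have "N +>\<^bsub>M\<^esub> (c \<odot>\<^bsub>M\<^esub> y) = N +>\<^bsub>M\<^esub> (c \<odot>\<^bsub>M\<^esub> x)" if y: "y \<in> N +>\<^bsub>M\<^esub> x" for y
    proof -
      have yM: "y \<in> carrier M" using S.a_elemrcos_carrier[OF x y] .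
      have "y \<ominus>\<^bsub>M\<^esub> x \<in> N"
        using y S.a_rcos_module[OF x yM] by (simp add: a_minus_def)
      then have "c \<odot>\<^bsub>M\<^esub> (y \<ominus>\<^bsub>M\<^esub> x) \<in> N" using c by auto
      then have "c \<odot>\<^bsub>M\<^esub> y \<ominus>\<^bsub>M\<^esub> c \<odot>\<^bsub>M\<^esub> x \<in> N"
        using c x yM by (simp add: a_minus_def M.smult_r_distr M.smult_r_minus)
      then show ?thesis using eq c x yM by auto
    qed
    then show ?thesis using S.a_rcos_self[OF x] by blast
  qed
  let ?Q = "quot_module M N"
  have carrier_Q: "carrier ?Q = (\<lambda>x. N +>\<^bsub>M\<^esub> x) ` carrier M"
    by (simp add: quot_module_def rc)
  have add_Q: "(N +>\<^bsub>M\<^esub> x) \<oplus>\<^bsub>?Q\<^esub> (N +>\<^bsub>M\<^esub> y) = N +>\<^bsub>M\<^esub> (x \<oplus>\<^bsub>M\<^esub> y)"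
    if "x \<in> carrier M" "y \<in> carrier M" for x y
    using S.a_rcos_sum[OF that] by (simp add: quot_module_def)
  have smult_Q: "c \<odot>\<^bsub>?Q\<^esub> (N +>\<^bsub>M\<^esub> x) = N +>\<^bsub>M\<^esub> (c \<odot>\<^bsub>M\<^esub> x)"
    if "c \<in> carrier K" "x \<in> carrier M" for c x
    using sm[OF that] by (simp add: quot_module_def)
  have zero_Q: "\<zero>\<^bsub>?Q\<^esub> = N +>\<^bsub>M\<^esub> \<zero>\<^bsub>M\<^esub>"
    using S.a_rcos_const[OF N.zero_closed] by (simp add: quot_module_def)
  show vsQ: "vectorspace K ?Q"
  proof (rule vs_criteria; (intro allI ballI impI)?)
    fix v assume "v \<in> carrier ?Q"
    then obtain x where x: "x \<in> carrier M" "v = N +>\<^bsub>M\<^esub> x" by (auto simp: carrier_Q)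
    show "\<exists>w\<in>carrier ?Q. v \<oplus>\<^bsub>?Q\<^esub> w = \<zero>\<^bsub>?Q\<^esub>"
      by (rule bexI[of _ "N +>\<^bsub>M\<^esub> (\<ominus>\<^bsub>M\<^esub> x)"])
        (use x in \<open>auto simp: carrier_Q add_Q zero_Q M.r_neg\<close>)
  qed (auto simp: carrier_Q add_Q zero_Q smult_Q M.a_ac M.smult_l_distr M.smult_r_distr
      M.smult_assoc1 M.field_axioms)
  show "linear_map K M ?Q (\<lambda>x. N +>\<^bsub>M\<^esub> x)"
    using vsQ M
    by (auto simp: linear_map_def mod_hom_def mod_hom_axioms_def vectorspace_def module_hom_def
        carrier_Q add_Q smult_Q)
qed

lemma linear_map_comp:
  assumes "linear_map K U V f" and "linear_map K V W g"
  shows "linear_map K U W (\<lambda>x. g (f x))"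
proof -
  have "f \<in> module_hom K U V" "g \<in> module_hom K V W"
    using assms by (simp_all add: linear_map_def mod_hom_def mod_hom_axioms_def)
  then have "(\<lambda>x. g (f x)) \<in> module_hom K U W"
    by (auto simp: module_hom_def Pi_iff)
  with assms show ?thesis
    by (simp add: linear_map_def mod_hom_def mod_hom_axioms_def)
qed

context Vec_functor
begin

lemma lim_vs: "vectorspace K (lim_restr F J)"
proof -
  interpret P: vectorspace K "dprod J (fiber F)" by (rule dprod_vs[OF field_axioms vs])
  let ?C = "{s \<in> carrier (dprod J (fiber F)).
    \<forall>p\<in>J. \<forall>q\<in>J. p \<le> q \<longrightarrow> trans_map F p q (s p) = s q}"
  have h: "trans_map F p q \<in> module_hom K (fiber F p) (fiber F q)"
    "trans_map F p q \<zero>\<^bsub>fiber F p\<^esub> = \<zero>\<^bsub>fiber F q\<^esub>" if "p \<le> q" for p q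
    using lin[OF that] mod_hom.f0_is_0[of K "fiber F p" "fiber F q" "trans_map F p q"]
    by (auto simp: linear_map_def mod_hom_def mod_hom_axioms_def)
  have "LinearCombinations.submodule K ?C (dprod J (fiber F))"
  proof (unfold_locales, goal_cases)
    case (2 v w)
    then have "v \<oplus>\<^bsub>dprod J (fiber F)\<^esub> w \<in> carrier (dprod J (fiber F))" by auto
    with 2 h show ?case by (auto simp: dprod_def module_hom_def PiE_iff)
  next
    case 3
    then show ?case using P.zero_closed h by (auto simp: dprod_def)
  next
    case (4 c v)
    then have "c \<odot>\<^bsub>dprod J (fiber F)\<^esub> v \<in> carrier (dprod J (fiber F))" by auto
    with 4 h show ?case by (auto simp: dprod_def module_hom_def PiE_iff)
  qed auto
  then have "subspace K ?C (dprod J (fiber F))"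
    by (simp add: subspace_def P.vectorspace_axioms)
  then show ?thesis
    unfolding lim_restr_def by (rule P.subspace_is_vs)
qed

lemma lim_proj_linear:
  assumes "a \<in> J"
  shows "linear_map K (lim_restr F J) (fiber F a) (\<lambda>s. s a)"
proof -
  have "(\<lambda>s. s a) \<in> module_hom K (lim_restr F J) (fiber F a)"
    using assms by (auto simp: module_hom_def lim_restr_def dprod_def)
  then show ?thesis
    using lim_vs[of J] vs[of a]
    by (simp add: linear_map_def mod_hom_def mod_hom_axioms_def vectorspace_def)
qed

lemma dsum_fiber_vs: "vectorspace K (dsum J (fiber F))"
  by (rule dsum_vs[OF field_axioms vs])

lemma dsum_inj_closed:
  "p \<in> J \<Longrightarrow> v \<in> carrier (fiber F p) \<Longrightarrow> dsum_inj J (fiber F) p v \<in> carrier (dsum J (fiber F))"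
  using dsum_inj_linear[where M = "fiber F", OF field_axioms vs, of p J]
  by (auto simp: linear_map_def mod_hom_def mod_hom_axioms_def module_hom_def)

lemma trans_closed:
  "p \<le> q \<Longrightarrow> v \<in> carrier (fiber F p) \<Longrightarrow> trans_map F p q v \<in> carrier (fiber F q)"
  using lin[of p q] by (auto simp: linear_map_def mod_hom_def mod_hom_axioms_def module_hom_def)

lemma colim_rels_subset:
  "{dsum_inj J (fiber F) p v \<ominus>\<^bsub>dsum J (fiber F)\<^esub> dsum_inj J (fiber F) q (trans_map F p q v)
      | p q v. p \<in> J \<and> q \<in> J \<and> p \<le> q \<and> v \<in> carrier (fiber F p)} \<subseteq> carrier (dsum J (fiber F))"
proof -
  interpret D: vectorspace K "dsum J (fiber F)" by (rule dsum_fiber_vs)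
  show ?thesis by (auto intro!: D.minus_closed dsum_inj_closed trans_closed)
qed

lemma colim_rels_submodule:
  "LinearCombinations.submodule K (colim_rels K F J) (dsum J (fiber F))"
proof -
  interpret D: vectorspace K "dsum J (fiber F)" by (rule dsum_fiber_vs)
  show ?thesis unfolding colim_rels_def by (rule D.span_is_submodule[OF colim_rels_subset])
qed

lemma colim_vs: "vectorspace K (colim_restr K F J)"
  unfolding colim_restr_def by (rule quot_module_vs[OF dsum_fiber_vs colim_rels_submodule])

lemma colim_inj_linear:
  assumes "a \<in> J"
  shows "linear_map K (fiber F a) (colim_restr K F J) (colim_inj K F J a)"
  using linear_map_comp[OF dsum_inj_linear[OF field_axioms vs assms]
      quot_module_proj[OF dsum_fiber_vs colim_rels_submodule]]
  by (simp add: colim_restr_def colim_inj_def[abs_def])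

lemma colim_inj_trans:
  assumes "p \<in> J" "q \<in> J" "p \<le> q" "v \<in> carrier (fiber F p)"
  shows "colim_inj K F J q (trans_map F p q v) = colim_inj K F J p v"
proof -
  interpret D: vectorspace K "dsum J (fiber F)" by (rule dsum_fiber_vs)
  have "dsum_inj J (fiber F) p v \<ominus>\<^bsub>dsum J (fiber F)\<^esub> dsum_inj J (fiber F) q (trans_map F p q v)
      \<in> colim_rels K F J"
    unfolding colim_rels_def using D.in_own_span[OF colim_rels_subset] assms by blast
  then show ?thesis
    using quot_module_proj_eq[OF dsum_fiber_vs colim_rels_submodule
        dsum_inj_closed[OF assms(1,4)] dsum_inj_closed[OF assms(2) trans_closed[OF assms(3,4)]]]
    by (simp add: colim_inj_def)
qed

lemma canonical_map_eq:
  assumes J: "J \<in> Con" and s: "s \<in> carrier (lim_restr F J)" and a: "a \<in> J"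
  shows "canonical_map K F J s = colim_inj K F J a (s a)"
proof -
  have sc: "s p \<in> carrier (fiber F p)" if "p \<in> J" for p
    using s that by (auto simp: lim_restr_def dprod_def)
  have le: "colim_inj K F J p (s p) = colim_inj K F J q (s q)"
    if "p \<in> J" "q \<in> J" "p \<le> q" for p q
    using colim_inj_trans[OF that sc[OF that(1)]] s that by (auto simp: lim_restr_def)
  have edge: "colim_inj K F J p (s p) = colim_inj K F J q (s q)"
    if "(p, q) \<in> hasse \<inter> J \<times> J" for p q
    using that le[of p q] le[of q p] by (auto simp: hasse_def covers_def less_imp_le)
  have path: "colim_inj K F J p (s p) = colim_inj K F J q (s q)"
    if "(p, q) \<in> (hasse \<inter> J \<times> J)\<^sup>*" for p q
    using that
  proof (induction rule: rtrancl_induct)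
    case (step x y)
    from step.IH edge[OF step.hyps(2)] show ?case by (rule trans)
  qed (rule refl)
  have "(SOME a. a \<in> J) \<in> J" using a by (rule someI)
  then have "((SOME a. a \<in> J), a) \<in> (hasse \<inter> J \<times> J)\<^sup>*"
    using J a unfolding Con_def by blast
  from path[OF this] show ?thesis
    unfolding canonical_map_def Let_def .
qed

lemma canonical_map_linear:
  assumes "J \<in> Con"
  shows "linear_map K (lim_restr F J) (colim_restr K F J) (canonical_map K F J)"
proof -
  have "(SOME a. a \<in> J) \<in> J" using assms by (auto simp: Con_def some_in_eq)
  from linear_map_comp[OF lim_proj_linear[OF this] colim_inj_linear[OF this]]
  show ?thesis by (simp add: canonical_map_def[abs_def] Let_def)
qed

end

subsection \<open>Interval modules and direct sums are functors\<close>

lemma interval_module_functor: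
  assumes K: "field K" and S: "poset_convex S"
  shows "Vec_functor K (interval_module K S)"
proof -
  interpret K: field K by (rule K)
  have vs: "vectorspace K (fiber (interval_module K S) p)" for p
    by (rule vs_criteria[OF K])
      (auto simp: interval_module_def K.a_ac K.m_ac K.l_distr K.r_distr intro: K.r_neg)
  have lin: "linear_map K (fiber (interval_module K S) p) (fiber (interval_module K S) q)
          (trans_map (interval_module K S) p q)" for p q
    using vs[of p] vs[of q]
    by (auto simp: linear_map_def mod_hom_def mod_hom_axioms_def vectorspace_def module_hom_def
        interval_module_def)
  show ?thesis
  proof (rule Vec_functor.intro[OF K Vec_functor_axioms.intro], goal_cases)
    case (4 p q r v)
    have "q \<in> S" if "p \<in> S" "r \<in> S"
      using S 4 that unfolding poset_convex_def by blast
    then show ?case by (auto simp: interval_module_def)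
  qed (use vs lin in \<open>auto simp: interval_module_def split: if_splits\<close>)
qed

end

theory Submission
  imports Defs
begin

text \<open>The decomposition gives every vector of \<open>F p\<close> finitely many nonzero coordinates, one for each
  bar containing \<open>p\<close>, and transition maps preserve or kill coordinates. A section over \<open>J\<close> has
  canonical image zero exactly if its coordinates at the bars containing \<open>J\<close> vanish. On the one
  hand, such a coordinate is a cocone on \<open>F\<close> restricted to \<open>J\<close> and hence factors through the colimit.
  On the other hand, if a bar misses some \<open>b \<in> J\<close>, then evaluating the canonical map at \<open>b\<close> shows
  that the corresponding coordinate of the section can be set to zero everywhere. So the image has
  a basis dual to these coordinates; it is finite since \<open>F a\<close> is finite-dimensional for \<open>a \<in> J\<close>.\<close>

section \<open>Dual families\<close>

text \<open>The ground field as a vector space over itself, so that linear functionals are linear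
  maps into it. A separate record is built because \<open>K\<close> is a ring scheme and carries no
  scalar multiplication of its own.\<close>

definition self_module :: "('k, 'c) ring_scheme \<Rightarrow> ('k, 'k) module" where
  "self_module K = \<lparr>carrier = carrier K, mult = undefined, one = undefined,
     zero = \<zero>\<^bsub>K\<^esub>, add = (\<oplus>\<^bsub>K\<^esub>), smult = (\<otimes>\<^bsub>K\<^esub>)\<rparr>"

lemma self_module_simps [simp]:
  "carrier (self_module K) = carrier K"
  "\<zero>\<^bsub>self_module K\<^esub> = \<zero>\<^bsub>K\<^esub>"
  "x \<oplus>\<^bsub>self_module K\<^esub> y = x \<oplus>\<^bsub>K\<^esub> y"
  "x \<odot>\<^bsub>self_module K\<^esub> y = x \<otimes>\<^bsub>K\<^esub> y"
  by (simp_all add: self_module_def)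

lemma self_module_vs:
  assumes "field K"
  shows "vectorspace K (self_module K)"
proof -
  interpret K: field K by (rule assms)
  show ?thesis
    by (rule vs_criteria[OF assms])
      (auto simp: K.a_ac K.m_ac K.l_distr K.r_distr intro: K.r_neg)
qed

lemma linear_mapI:
  assumes "vectorspace K V" "vectorspace K W"
    and "\<And>v. v \<in> carrier V \<Longrightarrow> f v \<in> carrier W"
    and "\<And>u v. u \<in> carrier V \<Longrightarrow> v \<in> carrier V \<Longrightarrow> f (u \<oplus>\<^bsub>V\<^esub> v) = f u \<oplus>\<^bsub>W\<^esub> f v"
    and "\<And>k v. k \<in> carrier K \<Longrightarrow> v \<in> carrier V \<Longrightarrow> f (k \<odot>\<^bsub>V\<^esub> v) = k \<odot>\<^bsub>W\<^esub> f v"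
  shows "linear_map K V W f"
  using assms
  by (auto simp: linear_map_def mod_hom_def mod_hom_axioms_def module_hom_def vectorspace_def)

context vectorspace
begin

text \<open>The functional \<open>c i\<close> kills every \<open>w j\<close> with \<open>j\<close>
  different from \<open>i\<close>, so applied to a linear relation it returns the coefficient of
  \<open>w i\<close>, which must therefore be zero.\<close>

lemma dual_family_indpt:
  assumes c: "\<And>i. i \<in> I \<Longrightarrow> linear_map K V (self_module K) (c i)"
    and w: "\<And>i. i \<in> I \<Longrightarrow> w i \<in> carrier V"
    and dual: "\<And>i j. i \<in> I \<Longrightarrow> j \<in> I \<Longrightarrow> c i (w j) = (if i = j then \<one>\<^bsub>K\<^esub> else \<zero>\<^bsub>K\<^esub>)"
  shows "inj_on w I" and "lin_indpt (w ` I)"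
proof -
  show "inj_on w I"
    by (rule inj_onI) (metis dual one_not_zero)
  show "lin_indpt (w ` I)"
  proof
    assume "lin_dep (w ` I)"
    then obtain A a i where A: "finite A" "A \<subseteq> w ` I" and a: "a \<in> A \<rightarrow> carrier K"
      and lc: "lincomb a A = \<zero>\<^bsub>V\<^esub>" and i: "i \<in> I" "w i \<in> A" and nz: "a (w i) \<noteq> \<zero>\<^bsub>K\<^esub>"
      unfolding lin_dep_def by blast
    interpret c: linear_map K V "self_module K" "c i" by (rule c[OF i(1)])
    have AV: "A \<subseteq> carrier V" using A w by auto
    have "A - {w i} \<subseteq> c.ker"
      using A(2) i AV dual by (auto simp: c.ker_def)
    \<comment> \<open>Since the kernel is a submodule, the rest of the relation is killed as a
      whole, without expanding its sum.\<close>
    then have "span (A - {w i}) \<subseteq> c.ker"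
      by (rule span_is_subset[OF _ c.ker_is_submodule])
    moreover have "lincomb a (A - {w i}) \<in> span (A - {w i})"
      unfolding span_def using A a by auto
    ultimately have 0: "c i (lincomb a (A - {w i})) = \<zero>\<^bsub>K\<^esub>"
      and cl: "lincomb a (A - {w i}) \<in> carrier V"
      by (auto simp: c.ker_def)
    have ai: "a (w i) \<in> carrier K" using a i by auto
    have "\<zero>\<^bsub>K\<^esub> = c i (a (w i) \<odot>\<^bsub>V\<^esub> w i \<oplus>\<^bsub>V\<^esub> lincomb a (A - {w i}))"
      using lincomb_del2[OF A(1) AV a i(2)] lc c.f0_is_0 by simp
    also have "\<dots> = a (w i)"
      using ai w[OF i(1)] cl 0 dual[OF i(1) i(1)] by simp
    finally show False using nz by simp
  qed
qed

text \<open>An independent set in a finite-dimensional space is finite, and \<open>w\<close> is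
  injective on \<open>I\<close>. This will bound the number of bars through a point.\<close>

lemma dual_family_finite:
  assumes c: "\<And>i. i \<in> I \<Longrightarrow> linear_map K V (self_module K) (c i)"
    and w: "\<And>i. i \<in> I \<Longrightarrow> w i \<in> carrier V"
    and dual: "\<And>i j. i \<in> I \<Longrightarrow> j \<in> I \<Longrightarrow> c i (w j) = (if i = j then \<one>\<^bsub>K\<^esub> else \<zero>\<^bsub>K\<^esub>)"
    and fin: fin_dim
  shows "finite I"
proof -
  note li = dual_family_indpt[where I = I and c = c and w = w, OF c w dual]
  have "w ` I \<subseteq> carrier V" using w by auto
  then have "finite (w ` I)" using fin_dim_li_fin[OF fin] li by blast
  then show ?thesis using li by (simp add: finite_image_iff)
qed

text \<open>The family \<open>w\<close> spans: subtracting \<open>c i v \<odot> w i\<close> from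
  \<open>v\<close> clears the coordinate at \<open>i\<close> and keeps all others, so induction on
  the number of nonzero coordinates reduces to a vector on which every functional vanishes, and
  \<open>separating\<close> makes that vector zero.\<close>

lemma dim_eq_card_dual_family:
  assumes c: "\<And>i. i \<in> I \<Longrightarrow> linear_map K V (self_module K) (c i)"
    and w: "\<And>i. i \<in> I \<Longrightarrow> w i \<in> carrier V"
    and dual: "\<And>i j. i \<in> I \<Longrightarrow> j \<in> I \<Longrightarrow> c i (w j) = (if i = j then \<one>\<^bsub>K\<^esub> else \<zero>\<^bsub>K\<^esub>)"
    and fin: "finite I"
    and separating: "\<And>v. v \<in> carrier V \<Longrightarrow> (\<And>i. i \<in> I \<Longrightarrow> c i v = \<zero>\<^bsub>K\<^esub>) \<Longrightarrow> v = \<zero>\<^bsub>V\<^esub>"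
  shows "dim = card I"
proof -
  note li = dual_family_indpt[where I = I and c = c and w = w, OF c w dual]
  have wV: "w ` I \<subseteq> carrier V" using w by auto
  interpret S: LinearCombinations.submodule K "span (w ` I)" V
    by (rule span_is_submodule[OF wV])
  have c_closed: "c i v \<in> carrier K" if "i \<in> I" "v \<in> carrier V" for i v
    using mod_hom.f_im[of K V "self_module K" "c i" v] c[OF that(1)] that(2)
    by (auto simp: linear_map_def)
  have "v \<in> span (w ` I)" if "v \<in> carrier V" for v
    using that
  proof (induction "card {i \<in> I. c i v \<noteq> \<zero>\<^bsub>K\<^esub>}" arbitrary: v rule: less_induct)
    case (less v)
    show ?case
    proof (cases "\<exists>i\<in>I. c i v \<noteq> \<zero>\<^bsub>K\<^esub>")
      case False
      then have "v = \<zero>\<^bsub>V\<^esub>" using separating less.prems by blast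
      then show ?thesis using S.zero_closed by simp
    next
      case True
      then obtain i where i: "i \<in> I" "c i v \<noteq> \<zero>\<^bsub>K\<^esub>" by blast
      let ?m = "c i v \<odot>\<^bsub>V\<^esub> w i"
      let ?u = "v \<ominus>\<^bsub>V\<^esub> ?m"
      have m: "?m \<in> span (w ` I)"
        using i c_closed less.prems in_own_span[OF wV] by (intro S.smult_closed) auto
      have mV: "?m \<in> carrier V" using i c_closed less.prems w by auto
      have cu: "c j ?u = (if j = i then \<zero>\<^bsub>K\<^esub> else c j v)" if j: "j \<in> I" for j
      proof -
        interpret c: linear_map K V "self_module K" "c j" by (rule c[OF j])
        have neg: "\<ominus>\<^bsub>V\<^esub> ?m = (\<ominus>\<^bsub>K\<^esub> c i v) \<odot>\<^bsub>V\<^esub> w i"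
          using smult_l_minus[of "c i v" "w i"] c_closed i less.prems w by simp
        have "c j ?u = c j v \<oplus>\<^bsub>K\<^esub> (\<ominus>\<^bsub>K\<^esub> c i v) \<otimes>\<^bsub>K\<^esub> c j (w i)"
          unfolding a_minus_def neg
          using c_closed i less.prems w by simp
        then show ?thesis
          using dual[OF j i(1)] c_closed[OF j less.prems] c_closed[OF i(1) less.prems]
          by (auto simp: R.r_neg)
      qed
      have "{j \<in> I. c j ?u \<noteq> \<zero>\<^bsub>K\<^esub>} \<subset> {j \<in> I. c j v \<noteq> \<zero>\<^bsub>K\<^esub>}"
      proof (rule psubsetI)
        show "{j \<in> I. c j ?u \<noteq> \<zero>\<^bsub>K\<^esub>} \<subseteq> {j \<in> I. c j v \<noteq> \<zero>\<^bsub>K\<^esub>}"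
          using cu by (auto split: if_splits)
        have "i \<in> {j \<in> I. c j v \<noteq> \<zero>\<^bsub>K\<^esub>}" "i \<notin> {j \<in> I. c j ?u \<noteq> \<zero>\<^bsub>K\<^esub>}"
          using cu[OF i(1)] i by auto
        then show "{j \<in> I. c j ?u \<noteq> \<zero>\<^bsub>K\<^esub>} \<noteq> {j \<in> I. c j v \<noteq> \<zero>\<^bsub>K\<^esub>}"
          by blast
      qed
      then have "card {j \<in> I. c j ?u \<noteq> \<zero>\<^bsub>K\<^esub>} < card {j \<in> I. c j v \<noteq> \<zero>\<^bsub>K\<^esub>}"
        using fin by (intro psubset_card_mono) auto
      then have "?u \<in> span (w ` I)" using less.hyps mV less.prems by auto
      then have "?u \<oplus>\<^bsub>V\<^esub> ?m \<in> span (w ` I)" using m by (rule S.m_closed)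
      moreover have "?u \<oplus>\<^bsub>V\<^esub> ?m = v"
        using mV less.prems by (simp add: a_minus_def M.add.m_assoc M.l_neg)
      ultimately show ?thesis by simp
    qed
  qed
  then have "gen_set (w ` I)" using span_is_subset2[OF wV] by auto
  then have "basis (w ` I)" using li wV by (simp add: basis_def)
  then show ?thesis using dim_basis[of "w ` I"] fin li by (simp add: card_image)
qed

end

text \<open>By \<open>ker\<close>, each \<open>c i\<close> vanishes on the kernel of
  \<open>T\<close> and so descends to the image. The descended functionals are dual to the vectors
  \<open>T (w i)\<close> and separate the image, so the rank is found without choosing bases of
  \<open>V\<close> or \<open>W\<close>.\<close>

lemma (in linear_map) dim_image_eq_card:
  assumes c: "\<And>i. i \<in> I \<Longrightarrow> linear_map K V (self_module K) (c i)"
    and w: "\<And>i. i \<in> I \<Longrightarrow> w i \<in> carrier V"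
    and dual: "\<And>i j. i \<in> I \<Longrightarrow> j \<in> I \<Longrightarrow> c i (w j) = (if i = j then \<one>\<^bsub>K\<^esub> else \<zero>\<^bsub>K\<^esub>)"
    and fin: "finite I"
    and ker: "\<And>v. v \<in> carrier V \<Longrightarrow> T v = \<zero>\<^bsub>W\<^esub> \<longleftrightarrow> (\<forall>i\<in>I. c i v = \<zero>\<^bsub>K\<^esub>)"
  shows "vectorspace.dim K (W\<lparr>carrier := T ` carrier V\<rparr>) = card I"
proof -
  have "vectorspace K (W\<lparr>carrier := T ` carrier V\<rparr>)"
    using W.subspace_is_vs[OF imT_is_subspace] by (simp add: im_def)
  then interpret im: vectorspace K "W\<lparr>carrier := T ` carrier V\<rparr>" .
  \<comment> \<open>The functional induced on the image: \<open>c i\<close> at an arbitrary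
    preimage. Independence of the choice is shown next.\<close>
  define d where "d i X = c i (SOME v. v \<in> carrier V \<and> T v = X)" for i X
  have d: "d i (T v) = c i v" if i: "i \<in> I" and v: "v \<in> carrier V" for i v
  proof -
    interpret c: linear_map K V "self_module K" "c i" by (rule c[OF i])
    define u where "u = (SOME u. u \<in> carrier V \<and> T u = T v)"
    have u: "u \<in> carrier V" "T u = T v"
      using someI[of "\<lambda>u. u \<in> carrier V \<and> T u = T v" v] v by (auto simp: u_def)
    \<comment> \<open>Two preimages of the same vector differ by an element of the kernel, on which
      \<open>c i\<close> vanishes.\<close>
    have "T (u \<ominus>\<^bsub>V\<^esub> v) = \<zero>\<^bsub>W\<^esub>"
      using u v by (simp add: a_minus_def W.module.M.r_neg)
    then have "c i (u \<ominus>\<^bsub>V\<^esub> v) = \<zero>\<^bsub>K\<^esub>"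
      using ker[of "u \<ominus>\<^bsub>V\<^esub> v"] u v i by auto
    moreover have "u = (u \<ominus>\<^bsub>V\<^esub> v) \<oplus>\<^bsub>V\<^esub> v"
      using u v by (simp add: a_minus_def V.module.M.add.m_assoc V.module.M.l_neg)
    then have "c i u = c i (u \<ominus>\<^bsub>V\<^esub> v) \<oplus>\<^bsub>K\<^esub> c i v"
      using c.f_add[of "u \<ominus>\<^bsub>V\<^esub> v" v] u v by simp
    ultimately show ?thesis
      using c.f_im[OF v] by (simp add: d_def u_def)
  qed
  have lin_d: "linear_map K (W\<lparr>carrier := T ` carrier V\<rparr>) (self_module K) (d i)" if i: "i \<in> I" for i
  proof -
    interpret c: linear_map K V "self_module K" "c i" by (rule c[OF i])
    show ?thesis
    proof (rule linear_mapI[OF im.vectorspace_axioms c.W.vectorspace_axioms])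
      fix X assume "X \<in> carrier (W\<lparr>carrier := T ` carrier V\<rparr>)"
      then show "d i X \<in> carrier (self_module K)" using d[OF i] c.f_im by auto
    next
      fix X Y assume "X \<in> carrier (W\<lparr>carrier := T ` carrier V\<rparr>)" "Y \<in> carrier (W\<lparr>carrier := T ` carrier V\<rparr>)"
      then obtain u v where "u \<in> carrier V" "v \<in> carrier V" "X = T u" "Y = T v" by auto
      then show "d i (X \<oplus>\<^bsub>W\<lparr>carrier := T ` carrier V\<rparr>\<^esub> Y) = d i X \<oplus>\<^bsub>self_module K\<^esub> d i Y"
        using d[OF i, of "u \<oplus>\<^bsub>V\<^esub> v"] d[OF i] by simp
    next
      fix k X assume "k \<in> carrier K" "X \<in> carrier (W\<lparr>carrier := T ` carrier V\<rparr>)"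
      moreover then obtain v where "v \<in> carrier V" "X = T v" by auto
      ultimately show "d i (k \<odot>\<^bsub>W\<lparr>carrier := T ` carrier V\<rparr>\<^esub> X) = k \<odot>\<^bsub>self_module K\<^esub> d i X"
        using d[OF i, of "k \<odot>\<^bsub>V\<^esub> v"] d[OF i] by simp
    qed
  qed
  show ?thesis
  proof (rule im.dim_eq_card_dual_family[where w = "\<lambda>i. T (w i)", OF lin_d _ _ fin])
    fix X assume X: "X \<in> carrier (W\<lparr>carrier := T ` carrier V\<rparr>)"
      and 0: "\<And>i. i \<in> I \<Longrightarrow> d i X = \<zero>\<^bsub>K\<^esub>"
    then obtain v where v: "v \<in> carrier V" "X = T v" by auto
    with 0 d have "\<forall>i\<in>I. c i v = \<zero>\<^bsub>K\<^esub>" by auto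
    \<comment> \<open>Separation comes from the other half of \<open>ker\<close>: a vector whose
      coordinates in \<open>I\<close> all vanish is sent to zero.\<close>
    with ker v show "X = \<zero>\<^bsub>W\<lparr>carrier := T ` carrier V\<rparr>\<^esub>" by simp
  qed (use w d dual in auto)
qed

section \<open>Maps out of direct sums and colimits\<close>

text \<open>The existence half of the universal property of the direct sum: \<open>h\<close> adds up
  the \<open>g i (f i)\<close> over the support of \<open>f\<close>, which is finite.\<close>

lemma dsum_cotuple:
  assumes K: "field K" and M: "\<And>i. i \<in> A \<Longrightarrow> vectorspace K (M i)"
    and N: "vectorspace K N" and g: "\<And>i. i \<in> A \<Longrightarrow> linear_map K (M i) N (g i)"
  obtains h where "linear_map K (dsum A M) N h"
    and "\<And>j v. j \<in> A \<Longrightarrow> v \<in> carrier (M j) \<Longrightarrow> h (dsum_inj A M j v) = g j v"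
proof -
  interpret N: vectorspace K N by (rule N)
  define supp where "supp f = {i \<in> A. f i \<noteq> \<zero>\<^bsub>M i\<^esub>}" for f
  define h where "h f = (\<Oplus>\<^bsub>N\<^esub>i\<in>supp f. g i (f i))" for f
  have gc: "g i v \<in> carrier N" if "i \<in> A" "v \<in> carrier (M i)" for i v
  proof -
    interpret g: linear_map K "M i" N "g i" by (rule g[OF that(1)])
    show ?thesis using that g.f_im by simp
  qed
  have g0: "g i \<zero>\<^bsub>M i\<^esub> = \<zero>\<^bsub>N\<^esub>" if "i \<in> A" for i
  proof -
    interpret g: linear_map K "M i" N "g i" by (rule g[OF that])
    show ?thesis by simp
  qed
  have gadd: "g i (u \<oplus>\<^bsub>M i\<^esub> v) = g i u \<oplus>\<^bsub>N\<^esub> g i v"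
    if "i \<in> A" "u \<in> carrier (M i)" "v \<in> carrier (M i)" for i u v
  proof -
    interpret g: linear_map K "M i" N "g i" by (rule g[OF that(1)])
    show ?thesis using that by simp
  qed
  have gsmult: "g i (k \<odot>\<^bsub>M i\<^esub> v) = k \<odot>\<^bsub>N\<^esub> g i v"
    if "i \<in> A" "k \<in> carrier K" "v \<in> carrier (M i)" for i k v
  proof -
    interpret g: linear_map K "M i" N "g i" by (rule g[OF that(1)])
    show ?thesis using that by simp
  qed
  have D: "f \<in> carrier (dsum A M) \<longleftrightarrow> f \<in> (\<Pi>\<^sub>E i\<in>A. carrier (M i)) \<and> finite (supp f)" for f
    by (simp add: dsum_def dprod_def supp_def)
  \<comment> \<open>Zero entries contribute nothing, so the values of \<open>h\<close> at several
    vectors can be compared over one common finite index set.\<close>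
  have h_eq: "h f = (\<Oplus>\<^bsub>N\<^esub>i\<in>X. g i (f i))"
    if "f \<in> carrier (dsum A M)" "finite X" "supp f \<subseteq> X" "X \<subseteq> A" for f X
    unfolding h_def
    by (rule N.M.add.finprod_mono_neutral_cong_left)
      (use that g0 gc in \<open>auto simp: D supp_def PiE_iff\<close>)
  interpret D: vectorspace K "dsum A M" by (rule dsum_vs[OF K M])
  have ops: "(u \<oplus>\<^bsub>dsum A M\<^esub> v) i = u i \<oplus>\<^bsub>M i\<^esub> v i" "(k \<odot>\<^bsub>dsum A M\<^esub> v) i = k \<odot>\<^bsub>M i\<^esub> v i"
    if "i \<in> A" for u v k i
    using that by (simp_all add: dsum_def dprod_def)
  show ?thesis
  proof
    show "linear_map K (dsum A M) N h"
    proof (rule linear_mapI[OF D.vectorspace_axioms N])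
      fix v assume "v \<in> carrier (dsum A M)"
      then show "h v \<in> carrier N"
        unfolding h_def by (intro N.M.finsum_closed) (auto simp: D supp_def intro!: gc)
    next
      fix u v assume u: "u \<in> carrier (dsum A M)" and v: "v \<in> carrier (dsum A M)"
      let ?w = "u \<oplus>\<^bsub>dsum A M\<^esub> v"
      have w: "?w \<in> carrier (dsum A M)" using u v by simp
      \<comment> \<open>Including the support of the sum itself avoids comparing it with the other
        two supports.\<close>
      let ?X = "supp u \<union> supp v \<union> supp ?w"
      have X: "finite ?X" "?X \<subseteq> A" using u v w by (auto simp: D supp_def)
      have "h ?w = (\<Oplus>\<^bsub>N\<^esub>i\<in>?X. g i (u i) \<oplus>\<^bsub>N\<^esub> g i (v i))"
        unfolding h_eq[OF w X(1) _ X(2), simplified]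
        by (rule N.M.finsum_cong') (use u v X in \<open>auto simp: ops gadd D PiE_iff subset_iff intro!: gc\<close>)
      also have "\<dots> = h u \<oplus>\<^bsub>N\<^esub> h v"
        using h_eq[OF u X(1) _ X(2)] h_eq[OF v X(1) _ X(2)] u v X
        by (subst N.M.finsum_addf) (auto simp: D PiE_iff subset_iff intro!: gc)
      finally show "h ?w = h u \<oplus>\<^bsub>N\<^esub> h v" .
    next
      fix k v assume k: "k \<in> carrier K" and v: "v \<in> carrier (dsum A M)"
      let ?w = "k \<odot>\<^bsub>dsum A M\<^esub> v"
      have w: "?w \<in> carrier (dsum A M)" using k v by simp
      let ?X = "supp v \<union> supp ?w"
      have X: "finite ?X" "?X \<subseteq> A" using v w by (auto simp: D supp_def)
      have "h ?w = (\<Oplus>\<^bsub>N\<^esub>i\<in>?X. k \<odot>\<^bsub>N\<^esub> g i (v i))"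
        unfolding h_eq[OF w X(1) _ X(2), simplified]
        by (rule N.M.finsum_cong') (use k v X in \<open>auto simp: ops gsmult D PiE_iff subset_iff intro!: gc\<close>)
      also have "\<dots> = k \<odot>\<^bsub>N\<^esub> h v"
        unfolding h_eq[OF v X(1) _ X(2), simplified] using k v X
        by (subst N.finsum_smult) (auto simp: D PiE_iff subset_iff intro!: gc)
      finally show "h ?w = k \<odot>\<^bsub>N\<^esub> h v" .
    qed
  next
    fix j v assume j: "j \<in> A" and v: "v \<in> carrier (M j)"
    interpret inj: linear_map K "M j" "dsum A M" "dsum_inj A M j"
      by (rule dsum_inj_linear[OF K M j])
    have "h (dsum_inj A M j v) = (\<Oplus>\<^bsub>N\<^esub>i\<in>{j}. g i (dsum_inj A M j v i))"
      by (rule h_eq[OF inj.f_im[OF v]]) (use j in \<open>auto simp: dsum_inj_def supp_def\<close>)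
    then show "h (dsum_inj A M j v) = g j v"
      using gc[OF j v] j by (simp add: dsum_inj_def)
  qed
qed

text \<open>A cocone factors through the colimit: the map it induces on the direct sum kills the
  colimit relations, and a vector that vanishes in the colimit has its copy in the direct sum among
  these relations.\<close>

lemma (in Vec_functor) cocone_zero_if_colim_inj_zero:
  assumes N: "vectorspace K N" and g: "\<And>p. p \<in> J \<Longrightarrow> linear_map K (fiber F p) N (g p)"
    and cocone: "\<And>p q v. p \<in> J \<Longrightarrow> q \<in> J \<Longrightarrow> p \<le> q \<Longrightarrow> v \<in> carrier (fiber F p) \<Longrightarrow>
      g q (trans_map F p q v) = g p v"
    and a: "a \<in> J" and v: "v \<in> carrier (fiber F a)"
    and zero: "colim_inj K F J a v = \<zero>\<^bsub>colim_restr K F J\<^esub>"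
  shows "g a v = \<zero>\<^bsub>N\<^esub>"
proof -
  interpret D: vectorspace K "dsum J (fiber F)" by (rule dsum_fiber_vs)
  obtain h where h: "linear_map K (dsum J (fiber F)) N h"
    and hi: "\<And>p v. p \<in> J \<Longrightarrow> v \<in> carrier (fiber F p) \<Longrightarrow> h (dsum_inj J (fiber F) p v) = g p v"
    using dsum_cotuple[where M = "fiber F" and A = J, OF field_axioms vs N g] by blast
  interpret h: linear_map K "dsum J (fiber F)" N h by (rule h)
  interpret aJ: linear_map K "fiber F a" "colim_restr K F J" "colim_inj K F J a"
    by (rule colim_inj_linear[OF a])
  interpret ia: linear_map K "fiber F a" "dsum J (fiber F)" "dsum_inj J (fiber F) a"
    by (rule dsum_inj_linear[OF field_axioms vs a])
  have "colim_rels K F J \<subseteq> h.ker"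
    unfolding colim_rels_def
  proof (rule D.span_is_subset[OF _ h.ker_is_submodule], safe)
    fix p q v assume pq: "p \<in> J" "q \<in> J" "p \<le> q" and v: "v \<in> carrier (fiber F p)"
    show "dsum_inj J (fiber F) p v \<ominus>\<^bsub>dsum J (fiber F)\<^esub>
        dsum_inj J (fiber F) q (trans_map F p q v) \<in> h.ker"
      using pq v cocone[OF pq v] hi trans_closed[OF pq(3) v] dsum_inj_closed
      by (simp add: h.ker_def a_minus_def h.W.module.M.r_neg)
        (metis h.W.module.M.r_neg h.f_im)
  qed
  moreover have "dsum_inj J (fiber F) a v \<in> colim_rels K F J"
  proof -
    have neg0: "\<ominus>\<^bsub>dsum J (fiber F)\<^esub> \<zero>\<^bsub>dsum J (fiber F)\<^esub> = \<zero>\<^bsub>dsum J (fiber F)\<^esub>"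
      by (rule D.M.minus_equality) simp_all
    have "colim_inj K F J a v = colim_inj K F J a \<zero>\<^bsub>fiber F a\<^esub>"
      using zero aJ.f0_is_0 by simp
    then have "dsum_inj J (fiber F) a v \<ominus>\<^bsub>dsum J (fiber F)\<^esub> \<zero>\<^bsub>dsum J (fiber F)\<^esub>
        \<in> colim_rels K F J"
      unfolding colim_inj_def
      using quot_module_proj_eq[OF dsum_fiber_vs colim_rels_submodule, of "dsum_inj J (fiber F) a v" J
          "\<zero>\<^bsub>dsum J (fiber F)\<^esub>"] v ia.f0_is_0 by simp
    then show ?thesis
      using dsum_inj_closed[OF a v] neg0 by (simp add: a_minus_def)
  qed
  ultimately show ?thesis
    using hi[OF a v] by (auto simp: h.ker_def)
qed

section \<open>Coordinates of an interval decomposable functor\<close>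

text \<open>The set \<open>A\<close> indexes the bars and \<open>S i\<close> is the interval
  underlying bar \<open>i\<close>, so equal intervals may occur under several indices. The value
  \<open>\<eta> p v i\<close> is the coordinate of \<open>v\<close> at bar \<open>i\<close>.\<close>

locale interval_decomposition = vec_functor K F
  for K :: "('k, 'c) ring_scheme" (structure) and F :: "('p::order, 'k, 'v) persmod" +
  fixes A :: "'i set" and S :: "'i \<Rightarrow> 'p set" and \<eta> :: "'p \<Rightarrow> 'v \<Rightarrow> 'i \<Rightarrow> 'k"
  assumes eta_linear: "linear_map K (fiber F p)
      (fiber (pers_dsum A (\<lambda>i. interval_module K (S i))) p) (\<eta> p)"
    and eta_bij: "bij_betw (\<eta> p) (carrier (fiber F p))
      (carrier (fiber (pers_dsum A (\<lambda>i. interval_module K (S i))) p))"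
    and eta_natural: "p \<le> q \<Longrightarrow> v \<in> carrier (fiber F p) \<Longrightarrow>
      \<eta> q (trans_map F p q v) = trans_map (pers_dsum A (\<lambda>i. interval_module K (S i))) p q (\<eta> p v)"
begin

lemma dsum_carrier:
  "f \<in> carrier (fiber (pers_dsum A (\<lambda>i. interval_module K (S i))) p) \<longleftrightarrow>
     f \<in> extensional A \<and> (\<forall>i\<in>A. f i \<in> carrier K) \<and> (\<forall>i\<in>A. p \<notin> S i \<longrightarrow> f i = \<zero>) \<and>
     finite {i \<in> A. f i \<noteq> \<zero>}"
  by (auto simp: pers_dsum_def dsum_def dprod_def interval_module_def PiE_iff split: if_splits)

lemma eta_carrier:
  assumes "v \<in> carrier (fiber F p)"
  shows "\<eta> p v \<in> extensional A" and "i \<in> A \<Longrightarrow> \<eta> p v i \<in> carrier K"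
    and "i \<in> A \<Longrightarrow> p \<notin> S i \<Longrightarrow> \<eta> p v i = \<zero>" and "finite {i \<in> A. \<eta> p v i \<noteq> \<zero>}"
  using bij_betwE[OF eta_bij] assms dsum_carrier by blast+

lemma coord_linear:
  assumes "i \<in> A"
  shows "linear_map K (fiber F p) (self_module K) (\<lambda>v. \<eta> p v i)"
proof -
  interpret e: linear_map K "fiber F p" "fiber (pers_dsum A (\<lambda>i. interval_module K (S i))) p" "\<eta> p"
    by (rule eta_linear)
  show ?thesis
  proof (rule linear_mapI[OF vs self_module_vs[OF field_axioms]])
    fix u v assume "u \<in> carrier (fiber F p)" "v \<in> carrier (fiber F p)"
    then show "\<eta> p (u \<oplus>\<^bsub>fiber F p\<^esub> v) i = \<eta> p u i \<oplus>\<^bsub>self_module K\<^esub> \<eta> p v i"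
      using e.f_add assms by (simp add: pers_dsum_def dsum_def dprod_def interval_module_def)
  next
    fix k v assume "k \<in> carrier K" "v \<in> carrier (fiber F p)"
    then show "\<eta> p (k \<odot>\<^bsub>fiber F p\<^esub> v) i = k \<odot>\<^bsub>self_module K\<^esub> \<eta> p v i"
      using e.f_smult assms by (simp add: pers_dsum_def dsum_def dprod_def interval_module_def)
  qed (use assms eta_carrier in auto)
qed

lemma coord_trans:
  assumes "p \<le> q" "v \<in> carrier (fiber F p)" "i \<in> A"
  shows "\<eta> q (trans_map F p q v) i = (if p \<in> S i \<and> q \<in> S i then \<eta> p v i else \<zero>)"
  using eta_natural[OF assms(1,2)] assms(3) by (simp add: pers_dsum_def interval_module_def)

text \<open>Together with \<open>coord_exists\<close> this expresses the bijectivity of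
  \<open>\<eta> p\<close> in coordinates, so that later arguments handle only families of
  scalars.\<close>

lemma coord_inject:
  assumes "v \<in> carrier (fiber F p)" "w \<in> carrier (fiber F p)"
    and "\<And>i. i \<in> A \<Longrightarrow> \<eta> p v i = \<eta> p w i"
  shows "v = w"
proof -
  have "\<eta> p v = \<eta> p w"
    using assms eta_carrier(1) by (intro extensionalityI[of _ A]) auto
  then show ?thesis
    using eta_bij[of p] assms by (auto simp: bij_betw_def inj_on_def)
qed

lemma coord_exists:
  assumes "\<And>i. i \<in> A \<Longrightarrow> f i \<in> carrier K" "\<And>i. i \<in> A \<Longrightarrow> p \<notin> S i \<Longrightarrow> f i = \<zero>"
    and "finite {i \<in> A. f i \<noteq> \<zero>}"
  shows "\<exists>v\<in>carrier (fiber F p). \<forall>i\<in>A. \<eta> p v i = f i"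
proof -
  \<comment> \<open>Elements of the direct sum are extensional, so \<open>f\<close> has to be cut
    down to \<open>A\<close>.\<close>
  have "restrict f A \<in> carrier (fiber (pers_dsum A (\<lambda>i. interval_module K (S i))) p)"
    using assms by (auto simp: dsum_carrier cong: conj_cong)
  then have "restrict f A \<in> \<eta> p ` carrier (fiber F p)"
    using eta_bij[of p] by (simp add: bij_betw_def)
  then obtain v where v: "v \<in> carrier (fiber F p)" "restrict f A = \<eta> p v" by blast
  have "\<forall>i\<in>A. \<eta> p v i = f i" by (simp flip: v(2))
  then show ?thesis using v(1) by blast
qed

text \<open>Each bar through \<open>p\<close> yields a vector with coordinate one there and zero
  elsewhere. These vectors are dual to the coordinate functionals of the finite-dimensional space
  \<open>fiber F p\<close>.\<close>

lemma finite_index_at: "finite {i \<in> A. p \<in> S i}"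
proof -
  interpret Fp: vectorspace K "fiber F p" by (rule vs)
  have "\<exists>v\<in>carrier (fiber F p). \<forall>j\<in>A. \<eta> p v j = (if j = i then \<one> else \<zero>)"
    if i: "i \<in> A" "p \<in> S i" for i
  proof -
    show ?thesis
    proof (rule coord_exists)
      show "finite {j \<in> A. (if j = i then \<one> else \<zero>) \<noteq> \<zero>}"
        by (rule finite_subset[of _ "{i}"]) (auto split: if_splits)
    qed (use i in auto)
  qed
  then obtain w where w: "\<And>i. i \<in> A \<Longrightarrow> p \<in> S i \<Longrightarrow> w i \<in> carrier (fiber F p)"
    "\<And>i j. i \<in> A \<Longrightarrow> p \<in> S i \<Longrightarrow> j \<in> A \<Longrightarrow> \<eta> p (w i) j = (if j = i then \<one> else \<zero>)"
    by metis
  show ?thesis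
    by (rule Fp.dual_family_finite[where c = "\<lambda>i v. \<eta> p v i" and w = w])
      (use w coord_linear in \<open>auto intro: fin_dim\<close>)
qed

section \<open>Sections over \<open>J\<close> in coordinates, and the kernel of the canonical
  map\<close>

lemma lim_carrier:
  assumes "s \<in> carrier (lim_restr F J)" "p \<in> J"
  shows "s p \<in> carrier (fiber F p)"
  using assms by (auto simp: lim_restr_def dprod_def)

lemma lim_coord_const:
  assumes s: "s \<in> carrier (lim_restr F J)" and "p \<in> J" "q \<in> J" "p \<le> q" "i \<in> A"
  shows "\<eta> q (s q) i = (if p \<in> S i \<and> q \<in> S i then \<eta> p (s p) i else \<zero>)"
proof -
  have "trans_map F p q (s p) = s q" using assms by (auto simp: lim_restr_def)
  then show ?thesis using coord_trans[of p q "s p" i] lim_carrier assms by auto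
qed

text \<open>Vectors are chosen pointwise from their coordinates. The transition maps respect the
  choice because vectors with equal coordinates are equal.\<close>

lemma lim_exists:
  assumes f: "\<And>p i. p \<in> J \<Longrightarrow> i \<in> A \<Longrightarrow> f p i \<in> carrier K"
    and out: "\<And>p i. p \<in> J \<Longrightarrow> i \<in> A \<Longrightarrow> p \<notin> S i \<Longrightarrow> f p i = \<zero>"
    and fin: "\<And>p. p \<in> J \<Longrightarrow> finite {i \<in> A. f p i \<noteq> \<zero>}"
    and compat: "\<And>p q i. p \<in> J \<Longrightarrow> q \<in> J \<Longrightarrow> p \<le> q \<Longrightarrow> i \<in> A \<Longrightarrow>
      f q i = (if p \<in> S i \<and> q \<in> S i then f p i else \<zero>)"
  obtains s where "s \<in> carrier (lim_restr F J)"
    and "\<And>p i. p \<in> J \<Longrightarrow> i \<in> A \<Longrightarrow> \<eta> p (s p) i = f p i"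
proof -
  have "\<exists>v\<in>carrier (fiber F p). \<forall>i\<in>A. \<eta> p v i = f p i" if "p \<in> J" for p
    using that by (intro coord_exists f out fin)
  then obtain s where s: "\<And>p. p \<in> J \<Longrightarrow> s p \<in> carrier (fiber F p)"
    "\<And>p i. p \<in> J \<Longrightarrow> i \<in> A \<Longrightarrow> \<eta> p (s p) i = f p i"
    by metis
  have "trans_map F p q (s p) = s q" if pq: "p \<in> J" "q \<in> J" "p \<le> q" for p q
  proof (rule coord_inject)
    show "trans_map F p q (s p) \<in> carrier (fiber F q)" using trans_closed s pq by blast
    show "s q \<in> carrier (fiber F q)" using s pq by blast
    show "\<eta> q (trans_map F p q (s p)) i = \<eta> q (s q) i" if "i \<in> A" for i
      using coord_trans[OF pq(3) s(1) that] compat[OF pq that] s(2) pq that by simp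
  qed
  then have "restrict s J \<in> carrier (lim_restr F J)"
    using s(1) by (auto simp: lim_restr_def dprod_def)
  then show ?thesis
    using that[of "restrict s J"] s(2) by simp
qed

text \<open>The bars with nonzero coordinate at \<open>a\<close> are deleted from the section one at
  a time, since each may miss a different point of \<open>J\<close>. The induction is on their
  number, and once none is left the section vanishes at \<open>a\<close>.\<close>

lemma canonical_map_zero_if_coords_zero:
  assumes J: "J \<in> Con" and a: "a \<in> J" and s: "s \<in> carrier (lim_restr F J)"
    and 0: "\<And>i. i \<in> A \<Longrightarrow> J \<subseteq> S i \<Longrightarrow> \<eta> a (s a) i = \<zero>"
  shows "canonical_map K F J s = \<zero>\<^bsub>colim_restr K F J\<^esub>"
  using s 0
proof (induction "card {i \<in> A. \<eta> a (s a) i \<noteq> \<zero>}" arbitrary: s rule: less_induct)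
  case (less s)
  note sc = lim_carrier[OF less.prems(1)]
  show ?case
  proof (cases "\<exists>i\<in>A. \<eta> a (s a) i \<noteq> \<zero>")
    case False
    interpret Fa: linear_map K "fiber F a" "colim_restr K F J" "colim_inj K F J a"
      by (rule colim_inj_linear[OF a])
    have "s a = \<zero>\<^bsub>fiber F a\<^esub>"
    proof (rule coord_inject)
      fix i assume i: "i \<in> A"
      interpret c: linear_map K "fiber F a" "self_module K" "\<lambda>v. \<eta> a v i"
        by (rule coord_linear[OF i])
      show "\<eta> a (s a) i = \<eta> a \<zero>\<^bsub>fiber F a\<^esub> i" using False i c.f0_is_0 by simp
    qed (use sc a in auto)
    then show ?thesis
      using canonical_map_eq[OF J less.prems(1) a] by simp
  next
    case True
    then obtain i where i: "i \<in> A" "\<eta> a (s a) i \<noteq> \<zero>" by blast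
    then obtain b where b: "b \<in> J" "b \<notin> S i" using less.prems(2) by blast
    \<comment> \<open>The section \<open>t\<close> is \<open>s\<close> with the coordinate at
      \<open>i\<close> deleted at every point of \<open>J\<close>. It is again a section because
      transition maps act on each coordinate separately.\<close>
    obtain t where t: "t \<in> carrier (lim_restr F J)"
      and tc: "\<And>p j. p \<in> J \<Longrightarrow> j \<in> A \<Longrightarrow> \<eta> p (t p) j = (if j = i then \<zero> else \<eta> p (s p) j)"
    proof (rule lim_exists[where J = J and f = "\<lambda>p j. if j = i then \<zero> else \<eta> p (s p) j"])
      show "finite {j \<in> A. (if j = i then \<zero> else \<eta> p (s p) j) \<noteq> \<zero>}" if "p \<in> J" for p
        by (rule finite_subset[OF _ eta_carrier(4)[OF sc[OF that]]]) auto
      show "(if j = i then \<zero> else \<eta> q (s q) j) =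
          (if p \<in> S j \<and> q \<in> S j then if j = i then \<zero> else \<eta> p (s p) j else \<zero>)"
        if "p \<in> J" "q \<in> J" "p \<le> q" "j \<in> A" for p q j
        using lim_coord_const[OF less.prems(1) that] by simp
    qed (use sc eta_carrier in auto)
    \<comment> \<open>Nothing is deleted at \<open>b\<close>: as \<open>b\<close> lies outside
      \<open>S i\<close>, the coordinate of \<open>s b\<close> at \<open>i\<close> is already zero.
      Evaluating the canonical map at \<open>b\<close> therefore cannot tell \<open>s\<close> from
      \<open>t\<close>.\<close>
    have "t b = s b"
      using lim_carrier[OF t b(1)] sc[OF b(1)] tc[OF b(1)] eta_carrier(3)[OF sc[OF b(1)] _ b(2)]
      by (intro coord_inject) auto
    then have "canonical_map K F J s = canonical_map K F J t"
      using canonical_map_eq[OF J _ b(1)] t less.prems(1) by simp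
    also have "\<dots> = \<zero>\<^bsub>colim_restr K F J\<^esub>"
    proof (rule less.hyps[OF _ t])
      have "i \<in> {j \<in> A. \<eta> a (s a) j \<noteq> \<zero>}" "i \<notin> {j \<in> A. \<eta> a (t a) j \<noteq> \<zero>}"
        and "{j \<in> A. \<eta> a (t a) j \<noteq> \<zero>} \<subseteq> {j \<in> A. \<eta> a (s a) j \<noteq> \<zero>}"
        using i tc[OF a] by (auto split: if_splits)
      then show "card {j \<in> A. \<eta> a (t a) j \<noteq> \<zero>} < card {j \<in> A. \<eta> a (s a) j \<noteq> \<zero>}"
        using eta_carrier(4)[OF sc[OF a]] by (intro psubset_card_mono) auto
      show "\<eta> a (t a) j = \<zero>" if "j \<in> A" "J \<subseteq> S j" for j
        using tc[OF a that(1)] less.prems(2)[OF that] by simp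
    qed
    finally show ?thesis .
  qed
qed

text \<open>Inside a bar that contains \<open>J\<close>, transition maps between points of
  \<open>J\<close> preserve the coordinate, so it is a cocone with vertex the ground field.\<close>

lemma coord_zero_if_canonical_map_zero:
  assumes J: "J \<in> Con" and a: "a \<in> J" and s: "s \<in> carrier (lim_restr F J)"
    and zero: "canonical_map K F J s = \<zero>\<^bsub>colim_restr K F J\<^esub>"
    and i: "i \<in> A" "J \<subseteq> S i"
  shows "\<eta> a (s a) i = \<zero>"
proof -
  have "\<eta> a (s a) i = \<zero>\<^bsub>self_module K\<^esub>"
  proof (rule cocone_zero_if_colim_inj_zero[where g = "\<lambda>p v. \<eta> p v i" and J = J])
    show "colim_inj K F J a (s a) = \<zero>\<^bsub>colim_restr K F J\<^esub>"
      using canonical_map_eq[OF J s a] zero by simp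
    show "\<eta> q (trans_map F p q v) i = \<eta> p v i"
      if "p \<in> J" "q \<in> J" "p \<le> q" "v \<in> carrier (fiber F p)" for p q v
      using coord_trans[OF that(3,4) i(1)] that i(2) by auto
  qed (use self_module_vs[OF field_axioms] coord_linear[OF i(1)] a lim_carrier[OF s a] in auto)
  then show ?thesis by simp
qed

lemma rk_eq_card:
  assumes J: "J \<in> Con"
  shows "finite {i \<in> A. J \<subseteq> S i}" and "rk K F J = card {i \<in> A. J \<subseteq> S i}"
proof -
  let ?I = "{i \<in> A. J \<subseteq> S i}"
  have "J \<noteq> {}" using J by (simp add: Con_def)
  then obtain a where a: "a \<in> J" by blast
  show fin: "finite ?I"
    by (rule finite_subset[OF _ finite_index_at[of a]]) (use a in auto)
  \<comment> \<open>For a bar containing \<open>J\<close>, the coordinate family that is constantly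
    one at this bar and zero at all others is compatible along \<open>J\<close>. The resulting
    sections are dual to the coordinates at \<open>a\<close>.\<close>
  have "\<exists>s\<in>carrier (lim_restr F J). \<forall>j\<in>A. \<eta> a (s a) j = (if j = i then \<one> else \<zero>)"
    if i: "i \<in> ?I" for i
  proof -
    have "finite {j \<in> A. (if j = i then \<one> else \<zero>) \<noteq> \<zero>}"
      by (rule finite_subset[of _ "{i}"]) (auto split: if_splits)
    then obtain s where "s \<in> carrier (lim_restr F J)"
      and "\<And>p j. p \<in> J \<Longrightarrow> j \<in> A \<Longrightarrow> \<eta> p (s p) j = (if j = i then \<one> else \<zero>)"
      by (rule lim_exists[where J = J and f = "\<lambda>p j. if j = i then \<one> else \<zero>", rotated 2])
        (use i in \<open>auto split: if_splits\<close>)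
    then show ?thesis using a by blast
  qed
  then have "\<forall>i\<in>?I. \<exists>s. s \<in> carrier (lim_restr F J) \<and>
      (\<forall>j\<in>A. \<eta> a (s a) j = (if j = i then \<one> else \<zero>))"
    by blast
  from bchoice[OF this] obtain w where w: "\<And>i. i \<in> ?I \<Longrightarrow> w i \<in> carrier (lim_restr F J)"
    "\<And>i j. i \<in> ?I \<Longrightarrow> j \<in> A \<Longrightarrow> \<eta> a (w i a) j = (if j = i then \<one> else \<zero>)"
    by blast
  show "rk K F J = card ?I"
    unfolding rk_def
  proof (rule linear_map.dim_image_eq_card[OF canonical_map_linear[OF J],
        where c = "\<lambda>i s. \<eta> a (s a) i" and w = w])
    show "linear_map K (lim_restr F J) (self_module K) (\<lambda>s. \<eta> a (s a) i)" if "i \<in> ?I" for i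
      by (rule linear_map_comp[OF lim_proj_linear[OF a] coord_linear]) (use that in auto)
    show "canonical_map K F J s = \<zero>\<^bsub>colim_restr K F J\<^esub> \<longleftrightarrow> (\<forall>i\<in>?I. \<eta> a (s a) i = \<zero>)"
      if "s \<in> carrier (lim_restr F J)" for s
    proof
      assume "canonical_map K F J s = \<zero>\<^bsub>colim_restr K F J\<^esub>"
      from coord_zero_if_canonical_map_zero[OF J a that this]
      show "\<forall>i\<in>?I. \<eta> a (s a) i = \<zero>" by simp
    next
      assume "\<forall>i\<in>?I. \<eta> a (s a) i = \<zero>"
      then show "canonical_map K F J s = \<zero>\<^bsub>colim_restr K F J\<^esub>"
        by (intro canonical_map_zero_if_coords_zero[OF J a that]) simp
    qed
    show "\<eta> a (w j a) i = (if i = j then \<one> else \<zero>)" if "i \<in> ?I" "j \<in> ?I" for i j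
      using w(2)[OF that(2), of i] that(1) by auto
  qed (rule w(1) fin, assumption?)+
qed

end

section \<open>From indexed bars to multiplicities\<close>

theorem proposition3p17:
  fixes K :: "('k, 'c) ring_scheme"
    and F :: "('p::order, 'k, 'v) persmod"
    and barc :: "'p set \<Rightarrow> nat"
    and J :: "'p set"
  assumes "poset_connected (UNIV :: 'p set)"
    and "\<And>p q :: 'p. p \<le> q \<Longrightarrow> finite {r. p \<le> r \<and> r \<le> q}"
    and "vec_functor K F"
    and "is_barcode K F barc"
    and "J \<in> Con"
  shows "finite {S. 0 < barc S \<and> J \<subseteq> S} \<and>
         rk K F J = (\<Sum>S | 0 < barc S \<and> J \<subseteq> S. barc S)"
proof -
  interpret vec_functor K F by (rule assms(3))
  let ?A = "{(S, i). i < barc S}"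
  let ?I = "{x \<in> ?A. J \<subseteq> fst x}"
  let ?T = "{S. 0 < barc S \<and> J \<subseteq> S}"
  have "(\<lambda>(S, i). interval_module K S) = (\<lambda>x::'p set \<times> nat. interval_module K (fst x))"
    by auto
  with assms(4) have "pers_iso K F (pers_dsum ?A (\<lambda>x. interval_module K (fst x)))"
    by (simp add: is_barcode_def)
  then obtain \<eta> where "interval_decomposition_axioms K F ?A fst \<eta>"
    unfolding pers_iso_def interval_decomposition_axioms_def by metis
  then have "interval_decomposition K F ?A fst \<eta>"
    by (rule interval_decomposition.intro[OF assms(3)])
  then interpret D: interval_decomposition K F ?A fst \<eta> .
  have I: "?I = (SIGMA S:?T. {..<barc S})" by auto
  \<comment> \<open>An interval of positive multiplicity has at least the copy with index zero, so
    finiteness passes from the bars containing \<open>J\<close> to their underlying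
    intervals.\<close>
  have T: "?T = fst ` ?I" by (auto simp: image_iff)
  have fin: "finite ?T" unfolding T using D.rk_eq_card(1)[OF assms(5)] by (rule finite_imageI)
  have "rk K F J = card (SIGMA S:?T. {..<barc S})"
    using D.rk_eq_card(2)[OF assms(5)] I by simp
  also have "\<dots> = (\<Sum>S | 0 < barc S \<and> J \<subseteq> S. barc S)"
    using fin by (subst card_SigmaI) auto
  finally show ?thesis using fin by blast
qed

end
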